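(* The class $\mathrm{Av}(123)$ is LR-splittable, and more precisely, it satisfies $$\mathrm{Av}(123)\subseteq \mathrm{Av}(463152)\odot_{\mathrm{LR}}\mathrm{Av}(463152).$$
   Context: A permutation of length $n\ge 1$ is a sequence of all the $n$ distinct numbers of $[n]=\{1,\dots,n\}$. A permutation $\pi$ contains $\sigma$ if some subsequence of $\pi$ is order-isomorphic to $\sigma$ (has the same relative order); such a subsequence is an occurrence of $\sigma$. Otherwise $\pi$ avoids $\sigma$, and $\mathrm{Av}(\sigma)$ is the set of all permutations avoiding $\sigma$. A permutation class is a set of permutations closed under taking contained permutations. An element $\pi_i$ is a left-to-right minimum (LR-minimum) of $\pi$ if it is smaller than all elements preceding it. A permutation $\pi$ is an LR-merge of permutations $\tau$ and $\sigma$ if the elements of $\pi$ that are not LR-minima can be partitioned into two disjoint (possibly empty) sequences such that one of them, together with all LR-minima of $\pi$, is an occurrence of $\tau$, and the other, together with all LR-minima of $\pi$, is an occurrence of $\sigma$. For permutation classes $A,B$, $A\odot_{\mathrm{LR}}B$ is the collection of all LR-merges of a permutation from $A$ with a permutation from $B$. A multiset $\{P_1,\dots,P_m\}$ of permutation classes is an LR-splitting of a permutation class $C$ if $C\subseteq P_1\odot_{\mathrm{LR}}\cdots\odot_{\mathrm{LR}}P_m$; it is nontrivial if no $P_i$ is a superset of $C$. $C$ is LR-splittable if it admits a nontrivial LR-splitting. *)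

theory Defs
  imports "HOL-Library.Multiset" "HOL-Library.Sublist"
begin

definition is_perm :: "nat list \<Rightarrow> bool" where
  "is_perm xs \<longleftrightarrow> xs \<noteq> [] \<and> distinct xs \<and> set xs = {1..length xs}"

definition order_iso :: "nat list \<Rightarrow> nat list \<Rightarrow> bool" where
  "order_iso xs ys \<longleftrightarrow> length xs = length ys \<and>
     (\<forall>i<length xs. \<forall>j<length xs. xs ! i < xs ! j \<longleftrightarrow> ys ! i < ys ! j)"

definition is_occurrence :: "nat list \<Rightarrow> nat list \<Rightarrow> nat list \<Rightarrow> bool" where
  "is_occurrence s \<sigma> \<pi> \<longleftrightarrow> subseq s \<pi> \<and> order_iso s \<sigma>"

definition contains :: "nat list \<Rightarrow> nat list \<Rightarrow> bool" where
  "contains \<pi> \<sigma> \<longleftrightarrow> (\<exists>s. is_occurrence s \<sigma> \<pi>)"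

definition Av :: "nat list \<Rightarrow> nat list set" where
  "Av \<sigma> = {\<pi>. is_perm \<pi> \<and> \<not> contains \<pi> \<sigma>}"

definition perm_class :: "nat list set \<Rightarrow> bool" where
  "perm_class C \<longleftrightarrow> (\<forall>\<pi>\<in>C. is_perm \<pi>) \<and>
     (\<forall>\<pi>\<in>C. \<forall>\<sigma>. is_perm \<sigma> \<longrightarrow> contains \<pi> \<sigma> \<longrightarrow> \<sigma> \<in> C)"

definition lr_minima :: "nat list \<Rightarrow> nat set" where
  "lr_minima \<pi> = {\<pi> ! i | i. i < length \<pi> \<and> (\<forall>j<i. \<pi> ! i < \<pi> ! j)}"

text \<open>The entries of a permutation are distinct, so a subsequence of \<open>\<pi>\<close> is determined
  by its set of values; the two sequences of the partition are given by the value sets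
  \<open>P\<close> and \<open>Q\<close>.\<close>

definition is_lr_merge :: "nat list \<Rightarrow> nat list \<Rightarrow> nat list \<Rightarrow> bool" where
  "is_lr_merge \<pi> \<tau> \<sigma> \<longleftrightarrow>
     (\<exists>P Q. P \<union> Q = set \<pi> - lr_minima \<pi> \<and> P \<inter> Q = {} \<and>
        is_occurrence (filter (\<lambda>x. x \<in> P \<union> lr_minima \<pi>) \<pi>) \<tau> \<pi> \<and>
        is_occurrence (filter (\<lambda>x. x \<in> Q \<union> lr_minima \<pi>) \<pi>) \<sigma> \<pi>)"

definition lr_merge :: "nat list set \<Rightarrow> nat list set \<Rightarrow> nat list set"
    (infixl "\<odot>\<^sub>L\<^sub>R" 70) where
  "A \<odot>\<^sub>L\<^sub>R B = {\<pi>. is_perm \<pi> \<and> (\<exists>\<tau>\<in>A. \<exists>\<sigma>\<in>B. is_lr_merge \<pi> \<tau> \<sigma>)}"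

text \<open>Merging is commutative and associative on permutation classes, because the
  subsequences in a merge keep exactly the LR-minima of \<open>\<pi>\<close> as their LR-minima. Hence
  neither the chosen enumeration \<open>P # Ps\<close> of the multiset nor the bracketing matters.
  The multiset is nonempty.\<close>

definition lr_splitting :: "nat list set multiset \<Rightarrow> nat list set \<Rightarrow> bool" where
  "lr_splitting M C \<longleftrightarrow> perm_class C \<and> (\<forall>P\<in>#M. perm_class P) \<and>
     (\<exists>P Ps. M = mset (P # Ps) \<and> C \<subseteq> foldl (\<odot>\<^sub>L\<^sub>R) P Ps)"

definition nontrivial_lr_splitting :: "nat list set multiset \<Rightarrow> nat list set \<Rightarrow> bool" where
  "nontrivial_lr_splitting M C \<longleftrightarrow> lr_splitting M C \<and> (\<forall>P\<in>#M. \<not> C \<subseteq> P)"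

definition lr_splittable :: "nat list set \<Rightarrow> bool" where
  "lr_splittable C \<longleftrightarrow> (\<exists>M. nontrivial_lr_splitting M C)"

end

theory Submission
  imports Defs
begin

text \<open>
  If \<open>\<pi>\<close> avoids 123, then its entries that are not LR-minima form a decreasing sequence, since an
  ascent among them would extend to a 123 by an LR-minimum to the lower left of its first entry.
  To each such entry \<open>x\<close> belong the LR-minima that lie to the left of and below \<open>x\<close>. The
  LR-minima also form a decreasing sequence, and in it those belonging to \<open>x\<close> form a nonempty
  interval, both of whose ends move weakly to the right as \<open>x\<close> runs along the decreasing sequence
  of non-minima. Call two non-minima linked if their intervals meet. In this interval graph,
  if two vertices are linked, then they are linked to everything between them
  (\<open>linked_convex\<close>).

  In an occurrence of 463152, the entries 4, 3 and 1 are LR-minima and 6, 5 and 2 are not. Here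
  4 links 6 with 5, and 1 links 5 with 2. An LR-minimum linking 6 with 2 would lie to the left of 3
  and below it, which is impossible as 3 is itself an LR-minimum. So the occurrence exhibits
  a failure of transitivity of the link relation
  (\<open>transitive_part_avoids_463152\<close>), and it suffices to partition the non-minima into two sets on
  each of which the link relation is transitive. A greedy procedure does this
  (\<open>convex_relation_two_colouring\<close>): take the first non-minimum together with everything linked
  to it as one group, and repeat with the rest. Members of one group are pairwise linked, members
  of groups that are not consecutive are never linked, and so the groups of even index and
  those of odd index give the two sets.

  The splitting is nontrivial because 463152 itself avoids 123.
\<close>

section \<open>Containment and standardization\<close>

lemma subseq_set_subset: "subseq xs ys \<Longrightarrow> set xs \<subseteq> set ys"
  by (auto elim: list_emb_set)

lemma order_iso_map:
  assumes "strict_mono_on (set xs) h"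
  shows "order_iso (map h xs) xs"
  using strict_mono_on_less[OF assms] by (simp add: order_iso_def)

lemma order_iso_imp_map:
  assumes iso: "order_iso xs ys" and dist: "distinct ys"
  obtains h where "strict_mono_on (set ys) h" and "xs = map h ys"
proof -
  define h where "h v = xs ! (THE i. i < length ys \<and> ys ! i = v)" for v
  have len: "length xs = length ys"
    using iso by (simp add: order_iso_def)
  have h_nth: "h (ys ! i) = xs ! i" if "i < length ys" for i
  proof -
    have "(THE j. j < length ys \<and> ys ! j = ys ! i) = i"
      using that dist by (intro the_equality) (auto simp: nth_eq_iff_index_eq)
    then show ?thesis by (simp add: h_def)
  qed
  have "strict_mono_on (set ys) h"
    using iso h_nth by (auto simp: strict_mono_on_def in_set_conv_nth order_iso_def)
  moreover have "xs = map h ys"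
    using len h_nth by (intro nth_equalityI) auto
  ultimately show thesis by (rule that)
qed

text \<open>Writing the occurrence of \<open>\<tau>\<close> in \<open>\<pi>\<close> as the image of \<open>\<tau>\<close> under a monotone relabelling \<open>h\<close>
  makes composition easy: \<open>h\<close> carries the occurrence of \<open>\<sigma>\<close> in \<open>\<tau>\<close> to one in \<open>\<pi>\<close>.\<close>

lemma contains_trans:
  assumes \<pi>\<tau>: "contains \<pi> \<tau>" and \<tau>\<sigma>: "contains \<tau> \<sigma>" and dist: "distinct \<tau>"
  shows "contains \<pi> \<sigma>"
proof -
  obtain s where s: "subseq s \<pi>" "order_iso s \<tau>"
    using \<pi>\<tau> by (auto simp: contains_def is_occurrence_def)
  obtain t where t: "subseq t \<tau>" "order_iso t \<sigma>"
    using \<tau>\<sigma> by (auto simp: contains_def is_occurrence_def)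
  obtain h where h: "strict_mono_on (set \<tau>) h" "s = map h \<tau>"
    using order_iso_imp_map[OF s(2) dist] .
  have "subseq (map h t) \<pi>"
    using subseq_map[OF t(1), of h] s(1) h(2) by (auto intro: subseq_order.trans)
  moreover have "set t \<subseteq> set \<tau>"
    using t(1) by (rule subseq_set_subset)
  then have "order_iso (map h t) t"
    using h(1) by (intro order_iso_map) (auto intro: monotone_on_subset)
  then have "order_iso (map h t) \<sigma>"
    using t(2) by (auto simp: order_iso_def)
  ultimately show ?thesis
    by (auto simp: contains_def is_occurrence_def)
qed

lemma perm_class_Av: "perm_class (Av \<sigma>)"
  unfolding perm_class_def Av_def
  using contains_trans by (auto simp: is_perm_def)

lemma standardization_exists:
  assumes "xs \<noteq> []" and dist: "distinct xs"
  obtains \<tau> where "is_perm \<tau>" and "order_iso xs \<tau>"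
proof -
  define r where "r x = card {y \<in> set xs. y \<le> x}" for x
  have mono: "strict_mono_on (set xs) r"
  proof (rule strict_mono_onI)
    fix x y assume "x \<in> set xs" "y \<in> set xs" "x < y"
    then have "{z \<in> set xs. z \<le> x} \<subset> {z \<in> set xs. z \<le> y}" by force
    then show "r x < r y" unfolding r_def by (simp add: psubset_card_mono)
  qed
  have inj: "inj_on r (set xs)"
    using mono by (rule strict_mono_on_imp_inj_on)
  have "r x \<in> {1..length xs}" if "x \<in> set xs" for x
  proof -
    have "{x} \<subseteq> {y \<in> set xs. y \<le> x}" using that by auto
    then have "1 \<le> r x" unfolding r_def using card_mono[of "{y \<in> set xs. y \<le> x}" "{x}"] by simp
    moreover have "r x \<le> card (set xs)" unfolding r_def by (intro card_mono) auto
    ultimately show ?thesis using dist by (simp add: distinct_card)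
  qed
  then have "r ` set xs = {1..length xs}"
    using inj dist by (intro card_subset_eq) (auto simp: card_image distinct_card)
  then have "is_perm (map r xs)"
    using assms inj by (auto simp: is_perm_def distinct_map)
  moreover have "order_iso xs (map r xs)"
    using order_iso_map[OF mono] by (auto simp: order_iso_def)
  ultimately show thesis by (rule that)
qed

text \<open>The parts of a merge are sequences of entries of \<open>\<pi>\<close>, not permutations; this lemma passes from
  pattern avoidance of a part to a permutation in the class that the part is an occurrence of.\<close>

lemma standardization_in_Av:
  assumes "xs \<noteq> []" "distinct xs" "subseq xs \<pi>" "\<not> contains xs \<sigma>"
  obtains \<tau> where "\<tau> \<in> Av \<sigma>" and "is_occurrence xs \<tau> \<pi>"
proof -
  obtain \<tau> where \<tau>: "is_perm \<tau>" "order_iso xs \<tau>"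
    using standardization_exists assms(1,2) by metis
  then have "contains xs \<tau>"
    by (auto simp: contains_def is_occurrence_def)
  then have "\<not> contains \<tau> \<sigma>"
    using contains_trans \<tau>(1) assms(4) by (auto simp: is_perm_def)
  then show thesis
    using that \<tau> assms(3) by (auto simp: Av_def is_occurrence_def)
qed

section \<open>Relative position of entries\<close>

definition precedes :: "'a list \<Rightarrow> 'a \<Rightarrow> 'a \<Rightarrow> bool" where
  "precedes xs x y \<longleftrightarrow> (\<exists>i j. i < j \<and> j < length xs \<and> xs ! i = x \<and> xs ! j = y)"

lemma precedes_trans:
  "distinct xs \<Longrightarrow> precedes xs x y \<Longrightarrow> precedes xs y z \<Longrightarrow> precedes xs x z"
  unfolding precedes_def
  by (metis less_trans nth_eq_iff_index_eq)

lemma precedes_total: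
  "x \<in> set xs \<Longrightarrow> y \<in> set xs \<Longrightarrow> x \<noteq> y \<Longrightarrow> precedes xs x y \<or> precedes xs y x"
  unfolding precedes_def in_set_conv_nth by (metis linorder_neqE_nat)

lemma subseq_imp_precedes:
  assumes "subseq [x, y] xs"
  shows "precedes xs x y"
proof -
  obtain us vs where "xs = us @ x # vs" "subseq [y] vs"
    using assms by (auto elim!: list_emb_ConsD[elim_format])
  then obtain j where "j < length vs" "vs ! j = y"
    by (auto simp: subseq_singleton_left in_set_conv_nth)
  then show ?thesis
    unfolding precedes_def \<open>xs = _\<close>
    by (intro exI[of _ "length us"] exI[of _ "length us + Suc j"]) (auto simp: nth_append)
qed

lemma increasing_triple_imp_contains_123:
  assumes "distinct \<pi>" "precedes \<pi> x y" "precedes \<pi> y z" "x < y" "y < z"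
  shows "contains \<pi> [1,2,3]"
proof -
  obtain i j k where ijk: "i < j" "j < k" "k < length \<pi>" "\<pi> ! i = x" "\<pi> ! j = y" "\<pi> ! k = z"
    using assms(1-3) unfolding precedes_def
    by (metis less_trans nth_eq_iff_index_eq)
  have d: "drop n \<pi> = take (m - n) (drop n \<pi>) @ \<pi> ! m # drop (Suc m) \<pi>"
    if "n \<le> m" "m < length \<pi>" for n m
    using that by (metis Cons_nth_drop_Suc append_take_drop_id drop_drop le_add_diff_inverse2)
  have "subseq [z] (drop (Suc j) \<pi>)"
    using ijk d[of "Suc j" k] by (metis Suc_leI list_emb_append2 subseq_Cons2 list_emb_Nil)
  then have "subseq [y, z] (drop (Suc i) \<pi>)"
    using ijk d[of "Suc i" j] by (metis Suc_leI list_emb_append2 subseq_Cons2 less_trans)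
  then have "subseq [x, y, z] (drop 0 \<pi>)"
    using ijk d[of 0 i] by (metis list_emb_append2 subseq_Cons2 less_trans le0)
  moreover have "order_iso [x, y, z] [1,2,3]"
    using assms(4,5) by (auto simp: order_iso_def less_Suc_eq numeral_3_eq_3)
  ultimately show ?thesis
    by (auto simp: contains_def is_occurrence_def)
qed

section \<open>Left-to-right minima of 123-avoiding permutations\<close>

lemma lr_minima_less:
  assumes "distinct \<pi>" "m \<in> lr_minima \<pi>" "precedes \<pi> x m"
  shows "m < x"
  using assms unfolding lr_minima_def precedes_def
  by (smt (verit) less_trans mem_Collect_eq nth_eq_iff_index_eq)

text \<open>An entry that is not an LR-minimum has an entry to its left that is no larger; descending in this way must
  stop at an LR-minimum.\<close>

lemma lr_minimum_below_index:
  assumes "i < length \<pi>"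
  shows "\<exists>j\<le>i. \<pi> ! j \<in> lr_minima \<pi> \<and> \<pi> ! j \<le> \<pi> ! i"
  using assms
proof (induction i rule: less_induct)
  case (less i)
  show ?case
  proof (cases "\<pi> ! i \<in> lr_minima \<pi>")
    case False
    then obtain k where "k < i" "\<pi> ! k \<le> \<pi> ! i"
      using less.prems by (auto simp: lr_minima_def not_less)
    with less show ?thesis
      by (metis le_trans less_imp_le_nat order_less_trans)
  qed auto
qed

lemma nonminimum_above_lr_minimum:
  assumes "x \<in> set \<pi> - lr_minima \<pi>"
  obtains m where "m \<in> lr_minima \<pi>" "precedes \<pi> m x" "m < x"
proof -
  obtain i where i: "i < length \<pi>" "\<pi> ! i = x"
    using assms by (auto simp: in_set_conv_nth)
  then obtain j where j: "j \<le> i" "\<pi> ! j \<in> lr_minima \<pi>" "\<pi> ! j \<le> \<pi> ! i"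
    using lr_minimum_below_index by blast
  then have "\<pi> ! j \<noteq> x" using assms by auto
  with i j have "j < i" "\<pi> ! j < x"
    by (auto simp: order.order_iff_strict)
  with i j show thesis
    using that unfolding precedes_def by blast
qed

text \<open>Otherwise an LR-minimum to the lower left of \<open>x\<close> would complete the ascent to a 123.\<close>

lemma ascent_bottom_is_lr_minimum:
  assumes "\<pi> \<in> Av [1,2,3]" "precedes \<pi> x y" "x < y"
  shows "x \<in> lr_minima \<pi>"
proof (rule ccontr)
  assume "x \<notin> lr_minima \<pi>"
  moreover have "x \<in> set \<pi>"
    using assms(2) by (auto simp: precedes_def)
  moreover have dist: "distinct \<pi>"
    using assms(1) by (simp add: Av_def is_perm_def)
  ultimately obtain m where "precedes \<pi> m x" "m < x"
    using nonminimum_above_lr_minimum by blast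
  then have "contains \<pi> [1,2,3]"
    using increasing_triple_imp_contains_123 dist assms(2,3) by blast
  then show False using assms(1) by (simp add: Av_def)
qed

lemma nonminima_decreasing:
  assumes "\<pi> \<in> Av [1,2,3]" "x \<in> set \<pi> - lr_minima \<pi>" "y \<in> set \<pi> - lr_minima \<pi>" "y < x"
  shows "precedes \<pi> x y"
  using precedes_total[of x \<pi> y] ascent_bottom_is_lr_minimum[of \<pi> y x] assms by auto

text \<open>For non-minima \<open>y \<le> x\<close> of a 123-avoiding \<open>\<pi>\<close>, the entry \<open>x\<close> does not come after \<open>y\<close>, so an
  LR-minimum to the left of \<open>x\<close> and below \<open>y\<close> is to the lower left of both: this is the
  symmetric relation of having a common LR-minimum to the lower left, written for the larger
  entry first.\<close>

definition linked :: "nat list \<Rightarrow> nat \<Rightarrow> nat \<Rightarrow> bool" where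
  "linked \<pi> x y \<longleftrightarrow> (\<exists>m\<in>lr_minima \<pi>. precedes \<pi> m x \<and> m < y)"

lemma linked_refl:
  assumes "x \<in> set \<pi> - lr_minima \<pi>"
  shows "linked \<pi> x x"
  using nonminimum_above_lr_minimum[OF assms] by (auto simp: linked_def)

lemma linked_convex:
  assumes "\<pi> \<in> Av [1,2,3]" "x \<in> set \<pi> - lr_minima \<pi>" "y \<in> set \<pi> - lr_minima \<pi>"
    and "z \<le> y" "y \<le> x" "linked \<pi> x z"
  shows "linked \<pi> x y \<and> linked \<pi> y z"
proof -
  obtain m where m: "m \<in> lr_minima \<pi>" "precedes \<pi> m x" "m < z"
    using assms(6) by (auto simp: linked_def)
  have "precedes \<pi> m y"
  proof (cases "y = x")
    case False
    then have "precedes \<pi> x y"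
      using nonminima_decreasing assms(1-3,5) by simp
    then show ?thesis
      using precedes_trans m(2) assms(1) by (auto simp: Av_def is_perm_def)
  qed (use m in simp)
  then show ?thesis
    using m assms(4) by (auto simp: linked_def intro: less_le_trans)
qed

section \<open>Greedy grouping for a convex relation\<close>

text \<open>\<open>f\<close> numbers the groups that arise by repeatedly removing the greatest remaining element with
  everything related to it. The first clause identifies the initial group; it is what
  lets the induction over the remaining elements control how group 0 meets group 1.\<close>

definition greedy_grouping :: "('a::linorder \<Rightarrow> 'a \<Rightarrow> bool) \<Rightarrow> 'a set \<Rightarrow> ('a \<Rightarrow> nat) \<Rightarrow> bool" where
  "greedy_grouping R A f \<longleftrightarrow>
    (\<forall>x\<in>A. f x = 0 \<longleftrightarrow> R (Max A) x) \<and>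
    (\<forall>x\<in>A. \<forall>y\<in>A. y \<le> x \<longrightarrow> f x = f y \<longrightarrow> R x y) \<and>
    (\<forall>x\<in>A. \<forall>y\<in>A. y \<le> x \<longrightarrow> R x y \<longrightarrow> f x \<le> f y \<and> f y \<le> Suc (f x))"

text \<open>Call the greatest element of a group its leader. Two members of a group are related because
  the leader is related to the smaller one and the larger one lies in between. If \<open>x\<close> is related to
  a smaller \<open>y\<close> outside the group of \<open>x\<close>, then the leader of the next group lies between \<open>x\<close> and \<open>y\<close>,
  so it is related to \<open>y\<close>, which puts \<open>y\<close> into that next group.\<close>

lemma convex_relation_grouping:
  fixes A :: "'a::linorder set" and R :: "'a \<Rightarrow> 'a \<Rightarrow> bool"
  assumes "finite A"
    and refl: "\<And>x. x \<in> A \<Longrightarrow> R x x"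
    and convex: "\<And>x y z. \<lbrakk>x \<in> A; y \<in> A; z \<in> A; z \<le> y; y \<le> x; R x z\<rbrakk> \<Longrightarrow> R x y \<and> R y z"
  shows "\<exists>f. greedy_grouping R A f"
  using assms
proof (induction A rule: finite_psubset_induct)
  case (psubset A)
  show ?case
  proof (cases "A = {}")
    case False
    define M where "M = Max A"
    have M: "M \<in> A" "\<And>x. x \<in> A \<Longrightarrow> x \<le> M"
      using psubset.hyps False by (auto simp: M_def)
    define B where "B = {x \<in> A. \<not> R M x}"
    have "B \<subset> A" using M psubset.prems(1)[of M] by (auto simp: B_def)
    have "\<exists>f. greedy_grouping R B f"
    proof (rule psubset.IH[OF \<open>B \<subset> A\<close>])
      show "R x x" if "x \<in> B" for x
        using psubset.prems(1) that \<open>B \<subset> A\<close> by blast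
      show "R x y \<and> R y z" if "x \<in> B" "y \<in> B" "z \<in> B" "z \<le> y" "y \<le> x" "R x z" for x y z
        using psubset.prems(2)[of x y z] that \<open>B \<subset> A\<close> by blast
    qed
    then obtain f where f: "greedy_grouping R B f" ..
    have f0: "f x = 0 \<longleftrightarrow> R (Max B) x" if "x \<in> B" for x
      using f that by (simp add: greedy_grouping_def)
    have feq: "R x y" if "x \<in> B" "y \<in> B" "y \<le> x" "f x = f y" for x y
      using f that by (simp add: greedy_grouping_def)
    have fR: "f x \<le> f y \<and> f y \<le> Suc (f x)" if "x \<in> B" "y \<in> B" "y \<le> x" "R x y" for x y
      using f that by (simp add: greedy_grouping_def)
    define g where "g x = (if R M x then 0 else Suc (f x))" for x
    have "g x = 0 \<longleftrightarrow> R (Max A) x" for x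
      by (simp add: g_def M_def)
    moreover have "R x y" if "x \<in> A" "y \<in> A" "y \<le> x" "g x = g y" for x y
      using that feq[of x y] psubset.prems(2)[of M x y] M
      by (auto simp: g_def B_def split: if_splits)
    moreover have "g x \<le> g y \<and> g y \<le> Suc (g x)" if xy: "x \<in> A" "y \<in> A" "y \<le> x" "R x y" for x y
    proof (cases "R M y")
      case True
      then have "R M x"
        using psubset.prems(2)[of M x y] M xy by blast
      then show ?thesis using True by (simp add: g_def)
    next
      case y: False
      then have "y \<in> B" using xy by (simp add: B_def)
      show ?thesis
      proof (cases "R M x")
        case True
        \<comment> \<open>\<open>Max B\<close> is the leader of the next group; it lies between \<open>x\<close> and \<open>y\<close>.\<close>
        have "finite B" using psubset.hyps \<open>B \<subset> A\<close> finite_subset by blast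
        then have L: "Max B \<in> B" "y \<le> Max B"
          using \<open>y \<in> B\<close> Max_in by auto
        have "Max B \<le> x"
          using psubset.prems(2)[of M "Max B" x] M L True xy by (force simp: B_def)
        then have "R (Max B) y"
          using psubset.prems(2)[of x "Max B" y] L xy by (auto simp: B_def)
        then show ?thesis using f0 \<open>y \<in> B\<close> True by (simp add: g_def)
      next
        case False
        then show ?thesis using y fR[of x y] xy by (simp add: g_def B_def)
      qed
    qed
    ultimately have "greedy_grouping R A g"
      by (simp add: greedy_grouping_def)
    then show ?thesis by blast
  qed (simp add: greedy_grouping_def)
qed

text \<open>Colour by the parity of the group number. Related elements lie in the same or in consecutive
  groups, so two related elements of the same colour share their group; hence a chain of two
  related pairs in one colour stays in a single group, whose members are pairwise related.\<close>

lemma convex_relation_two_colouring: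
  fixes A :: "'a::linorder set" and R :: "'a \<Rightarrow> 'a \<Rightarrow> bool"
  assumes "finite A"
    and "\<And>x. x \<in> A \<Longrightarrow> R x x"
    and "\<And>x y z. \<lbrakk>x \<in> A; y \<in> A; z \<in> A; z \<le> y; y \<le> x; R x z\<rbrakk> \<Longrightarrow> R x y \<and> R y z"
  shows "\<exists>P Q. P \<union> Q = A \<and> P \<inter> Q = {} \<and>
    (\<forall>S\<in>{P, Q}. \<forall>x\<in>S. \<forall>y\<in>S. \<forall>z\<in>S.
      z \<le> y \<longrightarrow> y \<le> x \<longrightarrow> R x y \<longrightarrow> R y z \<longrightarrow> R x z)"
proof -
  obtain f :: "'a \<Rightarrow> nat" where
    f: "\<forall>x\<in>A. \<forall>y\<in>A. y \<le> x \<longrightarrow> f x = f y \<longrightarrow> R x y"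
      "\<forall>x\<in>A. \<forall>y\<in>A. y \<le> x \<longrightarrow> R x y \<longrightarrow> f x \<le> f y \<and> f y \<le> Suc (f x)"
    using convex_relation_grouping[of A R, OF assms] by (auto simp: greedy_grouping_def)
  have eq: "f x = f y"
    if xy: "x \<in> A" "y \<in> A" "y \<le> x" "R x y" "even (f x) = even (f y)" for x y
  proof -
    have "f y = f x \<or> f y = Suc (f x)"
      using f(2)[rule_format, OF xy(1-4)] by linarith
    with xy(5) show ?thesis by auto
  qed
  have trans: "R x z"
    if "x \<in> A" "y \<in> A" "z \<in> A" "z \<le> y" "y \<le> x" "R x y" "R y z"
      "even (f x) = even (f y)" "even (f y) = even (f z)" for x y z
  proof -
    have "f x = f z" using eq that by metis
    then show ?thesis using f(1) that order_trans by blast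
  qed
  define P where "P = {x \<in> A. even (f x)}"
  define Q where "Q = {x \<in> A. odd (f x)}"
  have "\<forall>S\<in>{P, Q}. \<forall>x\<in>S. \<forall>y\<in>S. \<forall>z\<in>S. z \<le> y \<longrightarrow> y \<le> x \<longrightarrow> R x y \<longrightarrow> R y z \<longrightarrow> R x z"
  proof (intro ballI impI)
    fix S x y z
    assume "S \<in> {P, Q}" and xyz: "x \<in> S" "y \<in> S" "z \<in> S"
      and le: "z \<le> y" "y \<le> x" and R: "R x y" "R y z"
    then consider "S = P" | "S = Q" by blast
    then have "x \<in> A" "y \<in> A" "z \<in> A" "even (f x) = even (f y)" "even (f y) = even (f z)"
      using xyz by (cases; simp add: P_def Q_def)+
    then show "R x z" using trans le R by blast
  qed
  moreover have "P \<union> Q = A" "P \<inter> Q = {}"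
    by (auto simp: P_def Q_def)
  ultimately show ?thesis by (intro exI[of _ P] exI[of _ Q] conjI)
qed

section \<open>Splitting Av(123)\<close>

text \<open>The entry playing 3 is needed in the pattern: the shorter 35142 would only give the chain of
  links and would not exclude a link between its first and last non-minimum.\<close>

lemma transitive_part_avoids_463152:
  assumes \<pi>: "\<pi> \<in> Av [1,2,3]" and S: "S \<subseteq> set \<pi> - lr_minima \<pi>"
    and trans: "\<And>x y z. \<lbrakk>x \<in> S; y \<in> S; z \<in> S; z \<le> y; y \<le> x; linked \<pi> x y; linked \<pi> y z\<rbrakk>
      \<Longrightarrow> linked \<pi> x z"
  shows "\<not> contains (filter (\<lambda>x. x \<in> S \<union> lr_minima \<pi>) \<pi>) [4,6,3,1,5,2]"
proof
  let ?\<rho> = "filter (\<lambda>x. x \<in> S \<union> lr_minima \<pi>) \<pi>"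
  assume "contains ?\<rho> [4,6,3,1,5,2]"
  then obtain s where s: "subseq s ?\<rho>" "order_iso s [4,6,3,1,5,2]"
    by (auto simp: contains_def is_occurrence_def)
  have len: "length s = 6"
    using s(2) by (simp add: order_iso_def)
  \<comment> \<open>The letters \<open>a\<close>, \<open>b\<close>, \<open>c\<close>, \<open>d\<close>, \<open>e\<close>, \<open>f\<close> play 4, 6, 3, 1, 5, 2.\<close>
  then obtain a b c d e f where abc: "s = [a, b, c, d, e, f]"
    by (auto simp: length_Suc_conv eval_nat_numeral)
  have iso: "s ! i < s ! j \<longleftrightarrow> [4,6,3,1,5,2::nat] ! i < [4,6,3,1,5,2] ! j" if "i < 6" "j < 6" for i j
    using s(2) len that by (simp add: order_iso_def)
  have vals: "d < f" "f < c" "c < e" "a < e" "e < b" "a < b" "d < e"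
    using iso[of 3 5] iso[of 5 2] iso[of 2 4] iso[of 0 4] iso[of 4 1] iso[of 0 1] iso[of 3 4]
    by (simp_all add: abc)
  have sub: "subseq [a, b] s" "subseq [b, c] s" "subseq [c, e] s" "subseq [d, e] s" "subseq [d, f] s"
    by (auto simp: abc subseq_singleton_left)
  have prec: "precedes \<pi> x y" if "subseq [x, y] s" for x y
    using that s(1) by (meson subseq_filter_left subseq_imp_precedes subseq_order.trans)
  have dist: "distinct \<pi>"
    using \<pi> by (simp add: Av_def is_perm_def)
  have mem: "x \<in> S \<union> lr_minima \<pi>" if "x \<in> set s" for x
    using that subseq_set_subset[OF s(1)] by auto
  have inS: "y \<in> S" if "subseq [x, y] s" "x < y" for x y
    using lr_minima_less[OF dist _ prec[OF that(1)]] subseq_set_subset[OF that(1)] mem[of y] that(2)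
    by auto
  have inM: "x \<in> lr_minima \<pi>" if "subseq [x, y] s" "x < y" for x y
    using ascent_bottom_is_lr_minimum[OF \<pi> prec] that by blast
  have "b \<in> S" "e \<in> S" "f \<in> S"
    using inS sub vals by blast+
  have mins: "a \<in> lr_minima \<pi>" "d \<in> lr_minima \<pi>" "c \<in> lr_minima \<pi>"
    using inM sub vals by blast+
  have "linked \<pi> b e"
    using mins prec[OF sub(1)] vals by (auto simp: linked_def)
  moreover have "linked \<pi> e f"
    using mins prec[OF sub(4)] vals by (auto simp: linked_def)
  ultimately have "linked \<pi> b f"
    using trans[of b e f] \<open>b \<in> S\<close> \<open>e \<in> S\<close> \<open>f \<in> S\<close> vals by linarith
  then obtain m where m: "precedes \<pi> m b" "m < f"
    by (auto simp: linked_def)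
  \<comment> \<open>\<open>m\<close> is then to the left of the LR-minimum \<open>c\<close> and yet below it.\<close>
  have "precedes \<pi> m c"
    using precedes_trans[OF dist m(1)] prec[OF sub(2)] by simp
  then have "c < m"
    using lr_minima_less[OF dist] mins by blast
  with m vals show False by simp
qed

lemma Av_123_subset_lr_merge:
  "Av [1,2,3] \<subseteq> Av [4,6,3,1,5,2] \<odot>\<^sub>L\<^sub>R Av [4,6,3,1,5,2]"
proof
  fix \<pi> assume \<pi>: "\<pi> \<in> Av [1,2,3]"
  then have perm: "is_perm \<pi>" and dist: "distinct \<pi>"
    by (auto simp: Av_def is_perm_def)
  let ?N = "set \<pi> - lr_minima \<pi>"
  let ?part = "\<lambda>S. filter (\<lambda>x. x \<in> S \<union> lr_minima \<pi>) \<pi>"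
  have "\<exists>P Q. P \<union> Q = ?N \<and> P \<inter> Q = {} \<and>
    (\<forall>S\<in>{P, Q}. \<forall>x\<in>S. \<forall>y\<in>S. \<forall>z\<in>S.
      z \<le> y \<longrightarrow> y \<le> x \<longrightarrow> linked \<pi> x y \<longrightarrow> linked \<pi> y z \<longrightarrow> linked \<pi> x z)"
    by (rule convex_relation_two_colouring) (use linked_refl linked_convex[OF \<pi>] in simp_all)
  then obtain P Q where PQ: "P \<union> Q = ?N" "P \<inter> Q = {}"
    and trans: "\<forall>S\<in>{P, Q}. \<forall>x\<in>S. \<forall>y\<in>S. \<forall>z\<in>S.
      z \<le> y \<longrightarrow> y \<le> x \<longrightarrow> linked \<pi> x y \<longrightarrow> linked \<pi> y z \<longrightarrow> linked \<pi> x z"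
    by blast
  have "\<pi> ! 0 \<in> set \<pi> \<inter> lr_minima \<pi>"
    using perm by (auto simp: is_perm_def lr_minima_def)
  then have nonempty: "?part S \<noteq> []" for S
    by (auto simp: filter_empty_conv)
  have part: "\<exists>\<tau>\<in>Av [4,6,3,1,5,2]. is_occurrence (?part S) \<tau> \<pi>" if "S = P \<or> S = Q" for S
  proof -
    have "S \<subseteq> ?N"
      using that PQ(1) by blast
    then have "\<not> contains (?part S) [4,6,3,1,5,2]"
      by (rule transitive_part_avoids_463152[OF \<pi>]) (use trans that in blast)
    then show ?thesis
      using standardization_in_Av[OF nonempty] dist by (metis distinct_filter subseq_filter_left)
  qed
  obtain \<tau> where \<tau>: "\<tau> \<in> Av [4,6,3,1,5,2]" "is_occurrence (?part P) \<tau> \<pi>"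
    using part[of P] by auto
  obtain \<sigma> where \<sigma>: "\<sigma> \<in> Av [4,6,3,1,5,2]" "is_occurrence (?part Q) \<sigma> \<pi>"
    using part[of Q] by auto
  have "is_lr_merge \<pi> \<tau> \<sigma>"
    unfolding is_lr_merge_def using PQ \<tau>(2) \<sigma>(2) by (intro exI[of _ P] exI[of _ Q] conjI)
  then show "\<pi> \<in> Av [4,6,3,1,5,2] \<odot>\<^sub>L\<^sub>R Av [4,6,3,1,5,2]"
    unfolding lr_merge_def using perm \<tau>(1) \<sigma>(1) by auto
qed

lemma Av_123_not_subset: "\<not> Av [1,2,3] \<subseteq> Av [4,6,3,1,5,2]"
proof -
  let ?\<pi> = "[4,6,3,1,5,2::nat]"
  have "contains ?\<pi> ?\<pi>"
    by (auto simp: contains_def is_occurrence_def order_iso_def)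
  moreover have "\<not> contains ?\<pi> [1,2,3]"
  proof
    assume "contains ?\<pi> [1,2,3]"
    then obtain s where s: "subseq s ?\<pi>" "order_iso s [1,2,3]"
      by (auto simp: contains_def is_occurrence_def)
    have len: "length s = 3"
      using s(2) by (simp add: order_iso_def)
    then obtain a b c where abc: "s = [a, b, c]"
      by (auto simp: length_Suc_conv eval_nat_numeral)
    have "s ! i < s ! j \<longleftrightarrow> [1,2,3::nat] ! i < [1,2,3] ! j" if "i < 3" "j < 3" for i j
      using s(2) len that by (simp add: order_iso_def)
    from this[of 0 1] this[of 1 2] have "a < b" "b < c"
      by (simp_all add: abc)
    then show False
      using s(1) unfolding abc by (auto split: if_splits)
  qed
  moreover have "is_perm ?\<pi>"
    by (auto simp: is_perm_def)
  ultimately show ?thesis by (auto simp: Av_def)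
qed

theorem lemma5p2:
  shows "lr_splittable (Av [1,2,3]) \<and>
    Av [1,2,3] \<subseteq> Av [4,6,3,1,5,2] \<odot>\<^sub>L\<^sub>R Av [4,6,3,1,5,2]"
proof
  let ?B = "Av [4,6,3,1,5,2]"
  have "lr_splitting {#?B, ?B#} (Av [1,2,3])"
    unfolding lr_splitting_def
    using Av_123_subset_lr_merge perm_class_Av
    by (auto intro!: exI[of _ ?B] exI[of _ "[?B]"])
  then show "lr_splittable (Av [1,2,3])"
    unfolding lr_splittable_def nontrivial_lr_splitting_def
    using Av_123_not_subset by (intro exI[of _ "{#?B, ?B#}"]) auto
qed (rule Av_123_subset_lr_merge)

end
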